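(* Let $k\in\mathbb{D}$, let $n\ge 0$ be an integer, and let $k^{-1}$ denote the multiplicative inverse of $k$ modulo $3^n$. Then for every $x\in\mathbb{Z}/3^n\mathbb{Z}$, $$P_{k,n}(x)=P_{1,n}(k^{-1}x),\qquad\text{equivalently}\qquad P_{k,n}(kx)=P_{1,n}(x).$$
   Context: $\mathbb{D}$ denotes the set of integers $x$ with $x\equiv\pm1\pmod 6$. For $k\in\mathbb{D}$ and an odd integer $x$, the Syracuse map is $$\mathrm{Syr}_k(x)=\frac{3x+k}{2^{\nu(3x+k)}},$$ where $\nu(y)$ is the exponent of the largest power of $2$ dividing the nonzero integer $y$ (note $3x+k\neq0$ since $3\nmid k$). $\mathrm{Syr}_k(x)$ is again odd, and $\mathrm{Syr}_k^n$ denotes the $n$-fold iterate ($\mathrm{Syr}_k^0$ is the identity). For an integer $n\ge0$ and $y$ an integer (equivalently a residue class modulo $3^n$), define $$P_{k,n}(y)=\lim_{N\to\infty}\frac1N\sum_{z=1}^{N}\mathbf{1}\big(\mathrm{Syr}_k^n(2z+1)\equiv y \bmod 3^n\big),$$ where $\mathbf 1(\cdot)$ is $1$ if the condition is true and $0$ otherwise. $P_{1,n}$ is the case $k=1$. *)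

theory Defs
  imports Complex_Main "HOL-Number_Theory.Number_Theory"
begin

definition D6 :: "int set" where
  "D6 = {k. [k = 1] (mod 6) \<or> [k = -1] (mod 6)}"

definition Syr :: "int \<Rightarrow> int \<Rightarrow> int" where
  "Syr k x = (3 * x + k) div 2 ^ multiplicity 2 (3 * x + k)"

definition syr_freq :: "int \<Rightarrow> nat \<Rightarrow> int \<Rightarrow> nat \<Rightarrow> real" where
  "syr_freq k n y N =
     (1 / real N) * (\<Sum>z = 1..N. of_bool [(Syr k ^^ n) (2 * int z + 1) = y] (mod 3 ^ n))"

(* A residue class modulo 3 ^ n is given by an integer representative y;
   see P_cong for independence of the representative.
   The value of lim is meaningful only if the sequence converges. *)
definition P :: "int \<Rightarrow> nat \<Rightarrow> int \<Rightarrow> real" where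
  "P k n y = lim (syr_freq k n y)"

lemma syr_freq_cong:
  assumes "[y = y'] (mod 3 ^ n)"
  shows "syr_freq k n y = syr_freq k n y'"
  using assms by (auto simp: syr_freq_def cong_def fun_eq_iff)

lemma P_cong:
  assumes "[y = y'] (mod 3 ^ n)"
  shows "P k n y = P k n y'"
  using syr_freq_cong[OF assms] by (simp add: P_def)

lemma D6_nonzero:
  assumes "k \<in> D6"
  shows "3 * x + k \<noteq> 0"
proof -
  have "k mod 6 = 1 \<or> k mod 6 = 5"
    using assms by (auto simp: D6_def cong_def)
  thus ?thesis by presburger
qed

lemma coprime_D6_3_power:
  assumes "k \<in> D6"
  shows "coprime k (3 ^ n)"
proof -
  have "k mod 6 = 1 \<or> k mod 6 = 5"
    using assms by (auto simp: D6_def cong_def)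
  hence "\<not> 3 dvd k" by presburger
  hence "coprime 3 k" by (intro prime_imp_coprime) auto
  thus ?thesis by (simp add: coprime_commute)
qed

lemma odd_Syr:
  assumes "k \<in> D6"
  shows "odd (Syr k x)"
  unfolding Syr_def
  using multiplicity_decompose[of "3 * x + k" 2] D6_nonzero[OF assms] by simp

end

theory Submission
  imports Defs
begin

text \<open>
  Multiplication by \<open>k\<close> conjugates the two maps: \<open>3 k x + k = k (3 x + 1)\<close> and \<open>k\<close> is odd, so
  \<open>Syr k (k x) = k Syr 1 x\<close> and hence \<open>(Syr k ^^ n) (k x) = k (Syr 1 ^^ n) x\<close>
  (\<open>Syr_funpow_mult\<close>).  The two distributions nevertheless need an argument to be compared,
  since for \<open>\<bar>k\<bar> > 1\<close> the multiples of \<open>k\<close> are only a part of the starting points.  What makes the comparison work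
  is that \<open>(Syr k ^^ n) x\<close> modulo \<open>3 ^ n\<close> depends only on the \<open>n\<close> exponents of \<open>2\<close> that are
  divided out: each step multiplies by \<open>3\<close>, so after \<open>n\<close> steps \<open>x\<close> enters with the factor \<open>3 ^ n\<close>.  These exponents
  are a 2-adically local function of \<open>x\<close>, and \<open>x \<mapsto> k x\<close> permutes the odd residues modulo any power
  of \<open>2\<close>.

  Locality fails only for rare residue classes.  A class modulo \<open>2 ^ M\<close> is called tame if the iterate
  modulo \<open>3 ^ n\<close> is constant on it, in a form strong enough for induction.  The class of \<open>x\<close> can only
  fail to be tame if the \<open>n\<close> exponents use up all \<open>M\<close> binary digits, and a recursion on the first
  exponent bounds the number of these classes by \<open>(M + 1) ^ n\<close> (\<open>card_not_tame_le\<close>), which is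
  negligible against \<open>2 ^ M\<close>.  Thus the indicator of the event \<open>(Syr k ^^ n) x = y\<close> modulo \<open>3 ^ n\<close>
  is, up to arbitrarily small density, periodic; so its averages converge
  (\<open>convergent_averages\<close>).  Over one full period of \<open>2 ^ M\<close> starting points the counts for
  \<open>(k, k y)\<close> and \<open>(1, y)\<close> differ by at most the number of exceptional classes
  (\<open>sum_hit_diff_le\<close>), and \<open>M \<rightarrow> \<infinity>\<close> gives equality of the limits.
\<close>

section \<open>Residue classes on which the iterate is determined\<close>

text \<open>
  The case \<open>j = 0\<close> says that the iterate is constant modulo \<open>3 ^ n\<close> on the class of \<open>x\<close> modulo
  \<open>2 ^ M\<close>.  All \<open>j\<close> are included because the induction prepends a step of the map, after which the
  two points already agree modulo one more power of \<open>3\<close>.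
\<close>

definition tame :: "int \<Rightarrow> nat \<Rightarrow> nat \<Rightarrow> int \<Rightarrow> bool" where
  "tame k n M x \<longleftrightarrow>
     (\<forall>j x' x''. [x' = x] (mod 2 ^ M) \<longrightarrow> [x'' = x] (mod 2 ^ M) \<longrightarrow> [x' = x''] (mod 3 ^ j) \<longrightarrow>
        [(Syr k ^^ n) x' = (Syr k ^^ n) x''] (mod 3 ^ (n + j)))"

lemma tame_cong:
  assumes "tame k n M x" "[y = x] (mod 2 ^ M)"
  shows "[(Syr k ^^ n) y = (Syr k ^^ n) x] (mod 3 ^ n)"
proof -
  have "[y = x] (mod 3 ^ 0)" by (simp add: cong_def)
  then have "[(Syr k ^^ n) y = (Syr k ^^ n) x] (mod 3 ^ (n + 0))"
    using assms unfolding tame_def by (meson cong_refl)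
  then show ?thesis by simp
qed

lemma odd_D6: "k \<in> D6 \<Longrightarrow> odd k"
  unfolding D6_def cong_def by clarsimp presburger

lemma Syr_times_power:
  assumes "k \<in> D6"
  shows "3 * x + k = 2 ^ multiplicity 2 (3 * x + k) * Syr k x"
  unfolding Syr_def by (simp add: multiplicity_dvd)

lemma Syr_eqI:
  assumes "3 * x + k = 2 ^ a * y" "odd y"
  shows "multiplicity 2 (3 * x + k) = a" "Syr k x = y"
proof -
  show m: "multiplicity 2 (3 * x + k) = a"
    using assms by (intro multiplicity_eqI) (auto simp: mult.commute)
  show "Syr k x = y"
    unfolding Syr_def m using assms(1) by simp
qed

text \<open>
  The first \<open>a\<close> binary digits are spent on dividing out \<open>2 ^ a\<close>.  One further digit
  (\<open>M \<ge> 1\<close>) is needed to see that the quotient is odd, that is, that the exponent is the same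
  throughout the class.
\<close>

lemma Syr_cong:
  assumes k: "k \<in> D6" and a: "a = multiplicity 2 (3 * x + k)"
    and M: "M \<ge> 1" and x': "[x' = x] (mod 2 ^ (M + a))"
  shows "3 * x' + k = 2 ^ a * Syr k x'" "[Syr k x' = Syr k x] (mod 2 ^ M)"
proof -
  obtain t where t: "x' = x + 2 ^ (M + a) * t"
    using x' by (metis cong_iff_lin cong_sym)
  have eq: "3 * x' + k = 2 ^ a * (Syr k x + 2 ^ M * (3 * t))"
    using Syr_times_power[OF k, of x] unfolding a[symmetric] t
    by (simp add: algebra_simps power_add)
  have "odd (Syr k x + 2 ^ M * (3 * t))"
    using odd_Syr[OF k, of x] M by simp
  from Syr_eqI(2)[OF eq this] have S: "Syr k x' = Syr k x + 2 ^ M * (3 * t)" .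
  show "3 * x' + k = 2 ^ a * Syr k x'" using eq S by simp
  show "[Syr k x' = Syr k x] (mod 2 ^ M)" unfolding S by (simp add: cong_def)
qed

lemma tame_Suc:
  assumes k: "k \<in> D6" and a: "a = multiplicity 2 (3 * x + k)"
    and M: "M \<ge> 1" and tame: "tame k n M (Syr k x)"
  shows "tame k (Suc n) (M + a) x"
  unfolding tame_def
proof (intro allI impI)
  fix j x' x''
  assume x': "[x' = x] (mod 2 ^ (M + a))" and x'': "[x'' = x] (mod 2 ^ (M + a))"
    and j: "[x' = x''] (mod 3 ^ j)"
  have "2 ^ a * (Syr k x' - Syr k x'') = 3 * (x' - x'')"
    using Syr_cong(1)[OF k a M x'] Syr_cong(1)[OF k a M x''] by (simp add: algebra_simps)
  moreover have "3 ^ Suc j dvd 3 * (x' - x'')"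
    using j unfolding cong_iff_dvd_diff by (simp only: power_Suc mult_dvd_mono dvd_refl)
  ultimately have "3 ^ Suc j dvd 2 ^ a * (Syr k x' - Syr k x'')" by metis
  moreover have "coprime (3 ^ Suc j) (2 ^ a :: int)"
    by (simp del: power_Suc)
  ultimately have "[Syr k x' = Syr k x''] (mod 3 ^ Suc j)"
    by (simp add: coprime_dvd_mult_right_iff cong_iff_dvd_diff del: power_Suc)
  with Syr_cong(2)[OF k a M x'] Syr_cong(2)[OF k a M x''] tame
  have "[(Syr k ^^ n) (Syr k x') = (Syr k ^^ n) (Syr k x'')] (mod 3 ^ (n + Suc j))"
    unfolding tame_def by blast
  then show "[(Syr k ^^ Suc n) x' = (Syr k ^^ Suc n) x''] (mod 3 ^ (Suc n + j))"
    by (simp add: funpow_swap1)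
qed

text \<open>
  Split \<open>X\<close> by the exponent \<open>a\<close> of the first step.  For \<open>a < M\<close> the map \<open>Syr k\<close> sends distinct
  non-tame classes modulo \<open>2 ^ M\<close> to distinct non-tame classes modulo \<open>2 ^ (M - a)\<close> for \<open>n\<close> steps, and
  only the class of \<open>- k / 3\<close> has \<open>a \<ge> M\<close>.  With \<open>b n M\<close> the largest possible cardinality this is
  \<open>b (Suc n) M \<le> 1 + (\<Sum>a\<in>{1..<M}. b n (M - a))\<close>.  Arbitrary sets of representatives are allowed
  so that the image under \<open>Syr k\<close> need not be reduced modulo a power of \<open>2\<close>.
\<close>

lemma card_not_tame_le:
  assumes k: "k \<in> D6"
    and X: "\<And>x. x \<in> X \<Longrightarrow> odd x \<and> \<not> tame k n M x"
    and inj: "inj_on (\<lambda>x. x mod 2 ^ M) X"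
  shows "card X \<le> (M + 1) ^ n"
  using X inj
proof (induction n arbitrary: M X)
  case 0
  then have "X = {}" by (auto simp: tame_def)
  then show ?case by simp
next
  case (Suc n)
  define v where "v x = multiplicity 2 (3 * x + k)" for x
  define layer where "layer a = {x \<in> X. v x = a}" for a
  define rest where "rest = {x \<in> X. v x \<ge> M}"
  have v_pos: "v x \<ge> 1" if "x \<in> X" for x
  proof -
    have "2 dvd 3 * x + k" using Suc.prems(1)[OF that] odd_D6[OF k] by simp
    then have "2 ^ 1 dvd 3 * x + k" by simp
    then show ?thesis unfolding v_def
      by (rule multiplicity_geI[rotated 2]) (use D6_nonzero[OF k] in auto)
  qed
  have cancel3: "x = y" if "x \<in> X" "y \<in> X" "[3 * x + k = 3 * y + k] (mod 2 ^ M)" for x y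
  proof -
    have "[3 * x = 3 * y] (mod 2 ^ M)" using that(3) by (simp add: cong_add_rcancel)
    moreover have "coprime (3::int) (2 ^ M)" by simp
    ultimately have "[x = y] (mod 2 ^ M)" by (simp add: cong_mult_lcancel)
    with Suc.prems(2) that show ?thesis by (auto simp: inj_on_def cong_def)
  qed
  have layer_le: "card (layer a) \<le> (M + 1) ^ n" if a: "a \<in> {1..<M}" for a
  proof -
    have recover: "[3 * x + k = 3 * y + k] (mod 2 ^ M)"
      if "x \<in> layer a" "y \<in> layer a" "[Syr k x = Syr k y] (mod 2 ^ (M - a))" for x y
    proof -
      have "2 ^ a * 2 ^ (M - a) dvd 2 ^ a * (Syr k x - Syr k y)"
        using that(3) by (simp add: cong_iff_dvd_diff)
      moreover have "2 ^ a * 2 ^ (M - a) = (2 ^ M :: int)"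
        using a by (simp flip: power_add)
      moreover have "2 ^ a * (Syr k x - Syr k y) = (3 * x + k) - (3 * y + k)"
        using that(1,2) Syr_times_power[OF k, of x] Syr_times_power[OF k, of y]
        by (simp add: layer_def v_def algebra_simps)
      ultimately show ?thesis by (metis cong_iff_dvd_diff)
    qed
    have inj_Syr: "inj_on (Syr k) (layer a)"
    proof (rule inj_onI)
      fix x y assume xy: "x \<in> layer a" "y \<in> layer a" "Syr k x = Syr k y"
      show "x = y"
        using xy recover[of x y] by (intro cancel3) (auto simp: layer_def)
    qed
    have "card (Syr k ` layer a) \<le> (M - a + 1) ^ n"
    proof (rule Suc.IH)
      fix y assume "y \<in> Syr k ` layer a"
      then obtain x where x: "x \<in> X" "v x = a" "y = Syr k x" by (auto simp: layer_def)
      have "\<not> tame k n (M - a) y"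
      proof
        assume "tame k n (M - a) y"
        then have "tame k (Suc n) (M - a + a) x"
          using a x by (intro tame_Suc[OF k]) (auto simp: v_def)
        with a x(1) Suc.prems(1) show False by auto
      qed
      then show "odd y \<and> \<not> tame k n (M - a) y" using odd_Syr[OF k] x by simp
    next
      show "inj_on (\<lambda>y. y mod 2 ^ (M - a)) (Syr k ` layer a)"
      proof (rule inj_onI)
        fix y y' assume "y \<in> Syr k ` layer a" "y' \<in> Syr k ` layer a"
          and eq: "y mod 2 ^ (M - a) = y' mod 2 ^ (M - a)"
        then obtain x x' where x: "x \<in> layer a" "x' \<in> layer a" "y = Syr k x" "y' = Syr k x'"
          by blast
        have "x = x'"
          using x eq recover[of x x'] by (intro cancel3) (auto simp: layer_def cong_def)
        then show "y = y'" using x by simp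
      qed
    qed
    also have "\<dots> \<le> (M + 1) ^ n" by (intro power_mono) auto
    finally show ?thesis using inj_Syr by (simp add: card_image)
  qed
  have rest_le: "card rest \<le> 1"
  proof -
    have dvd: "2 ^ M dvd 3 * x + k" if "x \<in> rest" for x
      using that by (auto simp: rest_def v_def intro: multiplicity_dvd')
    have "x = y" if "x \<in> rest" "y \<in> rest" for x y
    proof (rule cancel3)
      have "2 ^ M dvd (3 * x + k) - (3 * y + k)" using that dvd by (intro dvd_diff) auto
      then show "[3 * x + k = 3 * y + k] (mod 2 ^ M)" by (metis cong_iff_dvd_diff)
    qed (use that in \<open>auto simp: rest_def\<close>)
    then show ?thesis by (metis (full_types) One_nat_def card_le_Suc0_iff_eq card.infinite zero_le)
  qed
  have "finite X"
  proof (rule finite_imageD[OF _ Suc.prems(2)])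
    have "(\<lambda>x. x mod 2 ^ M) ` X \<subseteq> {0..<2 ^ M}" by auto
    then show "finite ((\<lambda>x. x mod 2 ^ M) ` X)" by (rule finite_subset) simp
  qed
  then have fin: "finite (layer a)" "finite rest" for a by (auto simp: layer_def rest_def)
  have "X \<subseteq> rest \<union> (\<Union>a\<in>{1..<M}. layer a)"
    using v_pos by (auto simp: rest_def layer_def not_le)
  then have "card X \<le> card (rest \<union> (\<Union>a\<in>{1..<M}. layer a))"
    by (intro card_mono) (use fin in auto)
  also have "\<dots> \<le> card rest + card (\<Union>a\<in>{1..<M}. layer a)" by (rule card_Un_le)
  also have "card (\<Union>a\<in>{1..<M}. layer a) \<le> (\<Sum>a\<in>{1..<M}. card (layer a))"
    by (rule card_UN_le) simp
  also have "\<dots> \<le> (\<Sum>a\<in>{1..<M}. (M + 1) ^ n)" by (rule sum_mono) (rule layer_le)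
  also have "\<dots> \<le> M * (M + 1) ^ n" by simp
  finally have "card X \<le> 1 + M * (M + 1) ^ n" using rest_le by simp
  also have "\<dots> \<le> (M + 1) ^ n + M * (M + 1) ^ n"
    by (rule add_right_mono) (simp add: Suc_leI)
  finally show ?case by (simp add: algebra_simps)
qed

text \<open>
  The starting points are \<open>2 z + 1\<close> with \<open>z \<ge> 1\<close>; with the index counted from \<open>0\<close> they
  are \<open>2 z + 3\<close>, and \<open>z\<close> modulo \<open>2 ^ M\<close> corresponds to an odd residue modulo \<open>2 ^ Suc M\<close>.
\<close>

definition untame :: "int \<Rightarrow> nat \<Rightarrow> nat \<Rightarrow> nat set" where
  "untame k n M = {z \<in> {..<2 ^ M}. \<not> tame k n (Suc M) (2 * int z + 3)}"

lemma odd_cong_iff: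
  "[2 * a + 3 = 2 * b + 3] (mod 2 ^ Suc M) \<longleftrightarrow> [a = b] (mod 2 ^ M)" for a b :: int
proof -
  have "2 * a + 3 - (2 * b + 3) = 2 * (a - b)" by simp
  then show ?thesis unfolding cong_iff_dvd_diff by (simp only: power_Suc dvd_mult_cancel_left) simp
qed

lemma int_cong_less_imp_eq:
  assumes "[int a = int b] (mod 2 ^ M)" "a < 2 ^ M" "b < 2 ^ M"
  shows "a = b"
proof -
  have "[a = b] (mod 2 ^ M)" using assms(1) by (simp flip: cong_int_iff)
  then show ?thesis using assms by (simp add: cong_def)
qed

lemma card_untame_le:
  assumes "k \<in> D6"
  shows "card (untame k n M) \<le> (M + 2) ^ n"
proof -
  define f where "f z = 2 * int z + 3" for z
  have "inj_on f (untame k n M)" by (auto simp: inj_on_def f_def)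
  then have "card (untame k n M) = card (f ` untame k n M)" by (simp add: card_image)
  also have "\<dots> \<le> (Suc M + 1) ^ n"
  proof (rule card_not_tame_le[OF assms])
    show "inj_on (\<lambda>x. x mod 2 ^ Suc M) (f ` untame k n M)"
      by (rule inj_onI)
        (auto simp: f_def untame_def odd_cong_iff simp flip: cong_def simp del: power_Suc
          dest: int_cong_less_imp_eq)
  qed (auto simp: untame_def f_def)
  finally show ?thesis by simp
qed

section \<open>Averages of almost periodic sequences\<close>

lemma sum_lessThan_add:
  fixes u :: "nat \<Rightarrow> 'a::comm_monoid_add"
  shows "sum u {..<a + b} = sum u {..<a} + (\<Sum>r<b. u (a + r))"
  by (induction b) (simp_all add: add.assoc)

text \<open>
  Cut \<open>{..<N}\<close> into blocks of length \<open>Q\<close>.  Each full block reproduces the first one except at the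
  exceptional positions, which costs \<open>e\<close> on average; the incomplete last block and the matching
  fraction of a period cost at most \<open>Q\<close> each.
\<close>

lemma average_near_period_average:
  fixes u :: "nat \<Rightarrow> real" and Q N :: nat
  assumes u: "\<And>z. 0 \<le> u z" "\<And>z. u z \<le> 1" and Q: "Q > 0" and N: "N > 0"
    and e: "real (card {r \<in> {..<Q}. \<exists>q. u (q * Q + r) \<noteq> u r}) \<le> e * real Q"
  shows "\<bar>sum u {..<N} / real N - sum u {..<Q} / real Q\<bar> \<le> 2 * real Q / real N + e"
proof -
  define B where "B = {r \<in> {..<Q}. \<exists>q. u (q * Q + r) \<noteq> u r}"
  define S where "S = (\<lambda>N. sum u {..<N})"
  have block: "\<bar>(\<Sum>r<Q. u (q * Q + r)) - S Q\<bar> \<le> real (card B)" for q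
  proof -
    have "\<bar>(\<Sum>r<Q. u (q * Q + r)) - S Q\<bar> \<le> (\<Sum>r<Q. \<bar>u (q * Q + r) - u r\<bar>)"
      unfolding S_def by (simp only: sum_subtractf[symmetric] sum_abs)
    also have "\<dots> \<le> (\<Sum>r<Q. of_bool (r \<in> B))"
    proof (rule sum_mono)
      fix r assume "r \<in> {..<Q}"
      then show "\<bar>u (q * Q + r) - u r\<bar> \<le> of_bool (r \<in> B)"
        using u[of r] u[of "q * Q + r"] by (cases "r \<in> B") (auto simp: B_def)
    qed
    also have "\<dots> = real (card B)" by (simp add: B_def of_bool_def sum.If_cases Int_def)
    finally show ?thesis .
  qed
  have blocks: "\<bar>S (q * Q) - real q * S Q\<bar> \<le> real q * real (card B)" for q
  proof (induction q)
    case 0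
    then show ?case by (simp add: S_def)
  next
    case (Suc q)
    have "S (Suc q * Q) = S (q * Q) + (\<Sum>r<Q. u (q * Q + r))"
      unfolding S_def using sum_lessThan_add[of u "q * Q" Q] by (simp add: add.commute)
    with Suc block[of q] show ?case by (simp add: algebra_simps abs_le_iff)
  qed
  define q s where "q = N div Q" and "s = N mod Q"
  have Nqs: "N = q * Q + s" and s: "s < Q" using Q by (simp_all add: q_def s_def)
  have bounds: "0 \<le> (\<Sum>r<m. u (a + r))" "(\<Sum>r<m. u (a + r)) \<le> real m" for a m
    using sum_mono[of "{..<m}" "\<lambda>r. u (a + r)" "\<lambda>_. 1"] u by (auto intro: sum_nonneg)
  have SN: "S N = S (q * Q) + (\<Sum>r<s. u (q * Q + r))"
    unfolding Nqs S_def by (rule sum_lessThan_add)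
  have SQ: "0 \<le> S Q" "S Q \<le> real Q" using bounds[of 0 Q] by (simp_all add: S_def)
  have avg: "0 \<le> S Q / real Q" "S Q / real Q \<le> 1" using SQ Q by simp_all
  have "real N * (S Q / real Q) = real q * S Q + real s * (S Q / real Q)"
    using Q by (simp add: Nqs field_simps)
  moreover have "0 \<le> real s * (S Q / real Q)"
    by (rule mult_nonneg_nonneg[OF _ avg(1)]) simp
  moreover have "real s * (S Q / real Q) \<le> real s * 1"
    by (rule mult_left_mono[OF avg(2)]) simp
  moreover have "real q * real (card B) \<le> e * real N"
  proof -
    have "e \<ge> 0"
      using order_trans[OF of_nat_0_le_iff e] Q by (simp add: zero_le_mult_iff)
    have "real q * real (card B) \<le> real q * (e * real Q)"
      using e by (intro mult_left_mono) (auto simp: B_def)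
    also have "\<dots> = e * real (q * Q)" by simp
    also have "\<dots> \<le> e * real N" using \<open>e \<ge> 0\<close> by (intro mult_left_mono) (simp_all add: Nqs)
    finally show ?thesis .
  qed
  ultimately have "\<bar>S N - real N * (S Q / real Q)\<bar> \<le> 2 * real Q + e * real N"
    using blocks[of q] bounds[of "q * Q" s] SN of_nat_mono[OF less_imp_le[OF s], where 'a = real]
    unfolding abs_le_iff by linarith
  moreover have "S N / real N - S Q / real Q = (S N - real N * (S Q / real Q)) / real N"
    using N by (simp add: field_simps)
  ultimately have "\<bar>S N / real N - S Q / real Q\<bar> \<le> (2 * real Q + e * real N) / real N"
    using N by (simp add: divide_right_mono)
  also have "\<dots> = 2 * real Q / real N + e" using N by (simp add: field_simps)
  finally show ?thesis by (simp add: S_def)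
qed

text \<open>
  All late averages are close to the average over one approximate period, hence to each other; the
  limit need not be identified to obtain the Cauchy property.
\<close>

lemma convergent_averages:
  fixes u :: "nat \<Rightarrow> real"
  assumes u: "\<And>z. 0 \<le> u z" "\<And>z. u z \<le> 1"
    and approx: "\<And>e. e > 0 \<Longrightarrow> \<exists>Q>0. real (card {r \<in> {..<Q}. \<exists>q. u (q * Q + r) \<noteq> u r}) \<le> e * real Q"
  shows "convergent (\<lambda>N. sum u {..<N} / real N)"
proof (rule real_Cauchy_convergent, rule metric_CauchyI)
  fix e :: real assume e: "e > 0"
  then obtain Q where Q: "Q > 0"
    and card: "real (card {r \<in> {..<Q}. \<exists>q. u (q * Q + r) \<noteq> u r}) \<le> (e / 6) * real Q"
    using approx[of "e / 6"] by auto
  obtain N0 :: nat where N0: "real N0 > 12 * real Q / e" using reals_Archimedean2 by blast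
  have "N0 > 0" using N0 Q e by (metis divide_nonneg_pos less_le_trans mult_nonneg_nonneg not_gr_zero
        of_nat_0 of_nat_0_le_iff order_less_irrefl zero_le_numeral)
  have near: "\<bar>sum u {..<N} / real N - sum u {..<Q} / real Q\<bar> < e / 2" if "N \<ge> N0" for N
  proof -
    have N: "N > 0" "real N > 12 * real Q / e" using that \<open>N0 > 0\<close> N0 by auto
    have "2 * real Q / real N < e / 6" using N e by (simp add: field_simps)
    with average_near_period_average[OF u Q N(1) card] e show ?thesis by linarith
  qed
  show "\<exists>M. \<forall>m\<ge>M. \<forall>n\<ge>M. dist (sum u {..<m} / real m) (sum u {..<n} / real n) < e"
  proof (intro exI allI impI)
    fix m n assume "N0 \<le> m" "N0 \<le> n"
    with near[of m] near[of n]
    show "dist (sum u {..<m} / real m) (sum u {..<n} / real n) < e"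
      unfolding dist_real_def by linarith
  qed
qed

lemma polynomial_over_power2_tendsto_0:
  "(\<lambda>M. real ((M + 2) ^ n) / 2 ^ M) \<longlonglongrightarrow> 0"
proof -
  \<comment> \<open>an \<open>n\<close>-th power of \<open>M / c ^ M\<close> with \<open>c\<close> the \<open>n\<close>-th root of \<open>2\<close>\<close>
  have "(\<lambda>M. real (M ^ n) / 2 ^ M) \<longlonglongrightarrow> 0"
  proof (cases "n = 0")
    case True
    have "(\<lambda>M. (1 / 2 :: real) ^ M) \<longlonglongrightarrow> 0" by (rule LIMSEQ_realpow_zero) auto
    with True show ?thesis by (simp add: power_one_over)
  next
    case False
    then have "norm (root n 2) > 1" by simp
    then have "(\<lambda>M. of_nat M / root n 2 ^ M) \<longlonglongrightarrow> 0" by (rule lim_n_over_pown)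
    then have "(\<lambda>M. (of_nat M / root n 2 ^ M) ^ n) \<longlonglongrightarrow> 0 ^ n" by (rule tendsto_power)
    moreover have "(root n 2 ^ M) ^ n = 2 ^ M" for M
      using False by (metis power_mult mult.commute real_root_pow_pos2 not_gr_zero zero_le_numeral)
    ultimately show ?thesis using False by (simp add: power_divide power_0_left)
  qed
  then have "(\<lambda>M. real ((M + 2) ^ n) / 2 ^ (M + 2)) \<longlonglongrightarrow> 0"
    by (rule LIMSEQ_ignore_initial_segment)
  then have "(\<lambda>M. 4 * (real ((M + 2) ^ n) / 2 ^ (M + 2))) \<longlonglongrightarrow> 4 * 0"
    by (intro tendsto_mult_left)
  then show ?thesis by simp
qed

section \<open>Convergence of the frequencies\<close>

definition hit :: "int \<Rightarrow> nat \<Rightarrow> int \<Rightarrow> nat \<Rightarrow> real" where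
  "hit k n y z = of_bool [(Syr k ^^ n) (2 * int z + 3) = y] (mod 3 ^ n)"

lemma syr_freq_eq_average:
  "syr_freq k n y N = sum (hit k n y) {..<N} / real N"
proof -
  have shift: "2 * int (Suc z) + 1 = 2 * int z + 3" for z by simp
  show ?thesis unfolding syr_freq_def One_nat_def sum.atLeast1_atMost_eq hit_def shift by simp
qed

lemma convergent_syr_freq:
  assumes k: "k \<in> D6"
  shows "convergent (syr_freq k n y)"
  unfolding syr_freq_eq_average[abs_def]
proof (rule convergent_averages)
  fix e :: real assume "e > 0"
  then have "\<forall>\<^sub>F M in sequentially. real ((M + 2) ^ n) / 2 ^ M < e"
    using polynomial_over_power2_tendsto_0 order_tendstoD(2) by blast
  then obtain M where M: "real ((M + 2) ^ n) / 2 ^ M < e"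
    by (auto simp: eventually_sequentially)
  have "{r \<in> {..<2 ^ M}. \<exists>q. hit k n y (q * 2 ^ M + r) \<noteq> hit k n y r} \<subseteq> untame k n M"
  proof (clarsimp simp: untame_def)
    fix r q assume "r < 2 ^ M" and neq: "hit k n y (q * 2 ^ M + r) \<noteq> hit k n y r"
      and tame: "tame k n (Suc M) (2 * int r + 3)"
    have "[2 * int (q * 2 ^ M + r) + 3 = 2 * int r + 3] (mod 2 ^ Suc M)"
      unfolding odd_cong_iff by (simp add: cong_def)
    from tame_cong[OF tame this] neq show False
      unfolding hit_def by (simp add: cong_def)
  qed
  then have "card {r \<in> {..<2 ^ M}. \<exists>q. hit k n y (q * 2 ^ M + r) \<noteq> hit k n y r}
      \<le> card (untame k n M)"
    by (intro card_mono) (auto simp: untame_def)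
  also have "\<dots> \<le> (M + 2) ^ n" by (rule card_untame_le[OF k])
  finally have "real (card {r \<in> {..<2 ^ M}. \<exists>q. hit k n y (q * 2 ^ M + r) \<noteq> hit k n y r})
      \<le> real ((M + 2) ^ n)" by (rule of_nat_mono)
  also have "\<dots> \<le> e * real (2 ^ M)" using M by (simp add: field_simps)
  finally show "\<exists>Q>0. real (card {r \<in> {..<Q}. \<exists>q. hit k n y (q * Q + r) \<noteq> hit k n y r})
      \<le> e * real Q" by (intro exI[of _ "2 ^ M"]) simp
qed (auto simp: hit_def)

section \<open>Comparing the distributions for k and for 1\<close>

lemma Syr_mult:
  assumes k: "k \<in> D6"
  shows "Syr k (k * x) = k * Syr 1 x"
proof (rule Syr_eqI(2))
  have one: "1 \<in> D6" by (simp add: D6_def)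
  show "3 * (k * x) + k = 2 ^ multiplicity 2 (3 * x + 1) * (k * Syr 1 x)"
    using arg_cong[OF Syr_times_power[OF one, of x], of "\<lambda>t. k * t"] by (simp add: algebra_simps)
  show "odd (k * Syr 1 x)" using odd_Syr[OF one] odd_D6[OF k] by simp
qed

lemma Syr_funpow_mult:
  assumes "k \<in> D6"
  shows "(Syr k ^^ n) (k * x) = k * (Syr 1 ^^ n) x"
  by (induction n) (simp_all add: Syr_mult[OF assms])

text \<open>
  Multiplication by \<open>k\<close> permutes the odd residues modulo \<open>2 ^ Suc M\<close>.  The reduced representative of
  \<open>k x\<close> is in general a different integer from \<open>k x\<close>, but on a tame class the iterates of
  the two agree modulo \<open>3 ^ n\<close>, so only the exceptional classes contribute to the difference.
\<close>

lemma sum_hit_diff_le: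
  assumes k: "k \<in> D6"
  shows "\<bar>sum (hit k n (k * y)) {..<2 ^ M} - sum (hit 1 n y) {..<2 ^ M}\<bar> \<le> real ((M + 2) ^ n)"
proof -
  \<comment> \<open>the index of the representative of \<open>k (2 z + 3)\<close>\<close>
  define f where "f z = nat ((k * (2 * int z + 3) - 3) div 2 mod 2 ^ M)" for z
  have f_cong: "[2 * int (f z) + 3 = k * (2 * int z + 3)] (mod 2 ^ Suc M)" for z
  proof -
    define c where "c = (k * (2 * int z + 3) - 3) div 2"
    have "even (k * (2 * int z + 3) - 3)" using odd_D6[OF k] by simp
    then have c: "k * (2 * int z + 3) = 2 * c + 3" by (simp add: c_def)
    have "int (f z) = c mod 2 ^ M" by (simp add: f_def c_def)
    then show ?thesis unfolding c odd_cong_iff by (simp add: cong_def)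
  qed
  have f_less: "f z < 2 ^ M" for z
    by (simp add: f_def nat_less_iff)
  have f_inj: "inj_on f {..<2 ^ M}"
  proof (rule inj_onI)
    fix a b assume ab: "a \<in> {..<2 ^ M}" "b \<in> {..<2 ^ M}" "f a = f b"
    have "[k * (2 * int a + 3) = k * (2 * int b + 3)] (mod 2 ^ Suc M)"
      using cong_trans[OF cong_sym[OF f_cong[of a]], unfolded ab(3), OF f_cong[of b]] .
    moreover have "coprime k (2 ^ Suc M)" using odd_D6[OF k] by (simp del: power_Suc)
    ultimately have "[2 * int a + 3 = 2 * int b + 3] (mod 2 ^ Suc M)"
      using cong_mult_lcancel[of k "2 ^ Suc M" "2 * int a + 3" "2 * int b + 3"] by iprover
    then have "[int a = int b] (mod 2 ^ M)"
      unfolding odd_cong_iff .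
    then show "a = b" using ab by (auto intro: int_cong_less_imp_eq)
  qed
  have bij: "bij_betw f {..<2 ^ M} {..<2 ^ M}"
    unfolding bij_betw_def using f_inj f_less endo_inj_surj[of "{..<2 ^ M}" f]
    by (simp add: image_subset_iff)
  have pointwise: "\<bar>hit k n (k * y) (f z) - hit 1 n y z\<bar> \<le> of_bool (f z \<in> untame k n M)" for z
  proof (cases "f z \<in> untame k n M")
    case True
    then show ?thesis by (simp add: hit_def)
  next
    case False
    then have "tame k n (Suc M) (2 * int (f z) + 3)" using f_less by (simp add: untame_def)
    from tame_cong[OF this cong_sym[OF f_cong]]
    have "[k * (Syr 1 ^^ n) (2 * int z + 3) = (Syr k ^^ n) (2 * int (f z) + 3)] (mod 3 ^ n)"
      by (simp only: Syr_funpow_mult[OF k])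
    then have "hit k n (k * y) (f z) = of_bool [k * (Syr 1 ^^ n) (2 * int z + 3) = k * y] (mod 3 ^ n)"
      unfolding hit_def by (simp add: cong_def)
    also have "\<dots> = hit 1 n y z"
      unfolding hit_def using cong_mult_lcancel[OF coprime_D6_3_power[OF k]] by simp
    finally show ?thesis by simp
  qed
  have "sum (hit k n (k * y)) {..<2 ^ M} = (\<Sum>z<2 ^ M. hit k n (k * y) (f z))"
    using sum.reindex_bij_betw[OF bij] by metis
  then have "\<bar>sum (hit k n (k * y)) {..<2 ^ M} - sum (hit 1 n y) {..<2 ^ M}\<bar>
      \<le> (\<Sum>z<2 ^ M. \<bar>hit k n (k * y) (f z) - hit 1 n y z\<bar>)"
    by (simp only: sum_subtractf[symmetric] sum_abs)
  also have "\<dots> \<le> (\<Sum>z<2 ^ M. of_bool (f z \<in> untame k n M))"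
    by (rule sum_mono) (rule pointwise)
  also have "\<dots> = (\<Sum>z<2 ^ M. of_bool (z \<in> untame k n M))"
    by (rule sum.reindex_bij_betw[OF bij])
  also have "\<dots> = real (card (untame k n M))"
    by (simp add: untame_def of_bool_def sum.If_cases Int_def)
  also have "\<dots> \<le> real ((M + 2) ^ n)" using card_untame_le[OF k] by (rule of_nat_mono)
  finally show ?thesis .
qed

lemma P_mult:
  assumes k: "k \<in> D6"
  shows "P k n (k * y) = P 1 n y"
proof -
  have one: "1 \<in> D6" by (simp add: D6_def)
  have lim: "(\<lambda>M. syr_freq c n x (2 ^ M)) \<longlonglongrightarrow> P c n x" if "c \<in> D6" for c x
  proof -
    have "syr_freq c n x \<longlonglongrightarrow> P c n x"
      unfolding P_def using convergent_syr_freq[OF that] by (simp add: convergent_LIMSEQ_iff)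
    from LIMSEQ_subseq_LIMSEQ[OF this, of "\<lambda>M. 2 ^ M"] show ?thesis
      by (simp add: strict_mono_def o_def)
  qed
  have "(\<lambda>M. syr_freq k n (k * y) (2 ^ M) - syr_freq 1 n y (2 ^ M)) \<longlonglongrightarrow> 0"
  proof (rule tendsto_0_le[OF polynomial_over_power2_tendsto_0[of n]], rule always_eventually, rule allI)
    fix M
    show "norm (syr_freq k n (k * y) (2 ^ M) - syr_freq 1 n y (2 ^ M))
        \<le> norm (real ((M + 2) ^ n) / 2 ^ M) * 1"
      unfolding syr_freq_eq_average diff_divide_distrib[symmetric]
      using divide_right_mono[OF sum_hit_diff_le[OF k, of n y M], of "2 ^ M"] by simp
  qed
  moreover have "(\<lambda>M. syr_freq k n (k * y) (2 ^ M) - syr_freq 1 n y (2 ^ M)) \<longlonglongrightarrow> P k n (k * y) - P 1 n y"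
    by (intro tendsto_diff lim k one)
  ultimately show ?thesis using LIMSEQ_unique by fastforce
qed

theorem mainTheorem1:
  fixes k :: int and n :: nat
  assumes "k \<in> D6"
  shows "\<forall>x::int.
           convergent (syr_freq k n x) \<and>
           P k n x = P 1 n (modular_inverse (3 ^ n) k * x) \<and>
           P k n (k * x) = P 1 n x"
proof (intro allI conjI)
  fix x :: int
  show "convergent (syr_freq k n x)" by (rule convergent_syr_freq[OF assms])
  show "P k n (k * x) = P 1 n x" by (rule P_mult[OF assms])
  have "[k * modular_inverse (3 ^ n) k * x = 1 * x] (mod 3 ^ n)"
    using cong_modular_inverse1[of k "3 ^ n"] coprime_D6_3_power[OF assms, of n]
    by (intro cong_mult cong_refl) auto
  then have "P k n x = P k n (k * (modular_inverse (3 ^ n) k * x))"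
    by (intro P_cong) (simp add: mult.assoc cong_sym_eq)
  also have "\<dots> = P 1 n (modular_inverse (3 ^ n) k * x)" by (rule P_mult[OF assms])
  finally show "P k n x = P 1 n (modular_inverse (3 ^ n) k * x)" .
qed

end
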